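(* Let $P=P_1P_2\dots P_n$ be a convex polygon all of whose interior angles are strictly less than $180^\circ$. Let $Q_1,\dots,Q_{n-1}$ be points such that: every $Q_i$ lies outside the polygon $P$; the triangles $P_iQ_iP_{i+1}$ ($1\le i\le n-1$) pairwise do not intersect; and every $Q_i$ lies on the same side of the line $P_1P_n$ as the polygon $P$. Then $P$ can be subdivided into a disjoint union of convex, possibly empty, polygons $P=R_1\cup\dots\cup R_{n-1}$ such that for each $i$, every point of $R_i$ is visible from $Q_i$ through the segment $P_iP_{i+1}$ (equivalently, the union of $R_i$ and the triangle $P_iQ_iP_{i+1}$ is convex). *)

theory Defs
  imports "HOL-Analysis.Analysis"
begin

text \<open>A polygon with \<open>n\<close> vertices is given by its vertices \<open>P 1, \<dots>, P n\<close> in cyclic order;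
  the values of \<open>P\<close> outside \<open>{1..n}\<close> are irrelevant.\<close>

definition cyc_succ :: "nat \<Rightarrow> nat \<Rightarrow> nat" where
  "cyc_succ n i = i mod n + 1"

definition side :: "nat \<Rightarrow> (nat \<Rightarrow> real^2) \<Rightarrow> nat \<Rightarrow> (real^2) set" where
  "side n P i = closed_segment (P i) (P (cyc_succ n i))"

definition polygon_region :: "nat \<Rightarrow> (nat \<Rightarrow> real^2) \<Rightarrow> (real^2) set" where
  "polygon_region n P = convex hull (P ` {1..n})"

text \<open>The closed polygonal line through \<open>P 1, \<dots>, P n\<close> is simple and bounds a convex region,
  which is then the convex hull of the vertices. Straight angles at vertices are allowed here.\<close>

definition convex_polygon :: "nat \<Rightarrow> (nat \<Rightarrow> real^2) \<Rightarrow> bool" where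
  "convex_polygon n P \<longleftrightarrow>
     3 \<le> n \<and> inj_on P {1..n} \<and>
     (\<forall>i\<in>{1..n}. \<forall>j\<in>{1..n}. i \<noteq> j \<longrightarrow>
        side n P i \<inter> side n P j \<subseteq> {P i, P (cyc_succ n i)} \<inter> {P j, P (cyc_succ n j)}) \<and>
     frontier (polygon_region n P) = (\<Union>i\<in>{1..n}. side n P i)"

text \<open>Unoriented angle \<open>abc\<close> at \<open>b\<close>, in \<open>[0, pi]\<close>. In a convex polygon no interior angle exceeds
  \<open>pi\<close>, so this is the interior angle when \<open>a, b, c\<close> are consecutive vertices.\<close>

definition angle_at :: "real^2 \<Rightarrow> real^2 \<Rightarrow> real^2 \<Rightarrow> real" where
  "angle_at a b c = arccos (((a - b) \<bullet> (c - b)) / (norm (a - b) * norm (c - b)))"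

definition interior_angle :: "nat \<Rightarrow> (nat \<Rightarrow> real^2) \<Rightarrow> nat \<Rightarrow> real" where
  "interior_angle n P i =
     angle_at (P (if i = 1 then n else i - 1)) (P i) (P (cyc_succ n i))"

definition triangle :: "real^2 \<Rightarrow> real^2 \<Rightarrow> real^2 \<Rightarrow> (real^2) set" where
  "triangle a b c = convex hull {a, b, c}"

text \<open>\<open>x\<close> and \<open>y\<close> lie strictly on the same side of the line through \<open>a\<close> and \<open>b\<close>.\<close>

definition same_side :: "real^2 \<Rightarrow> real^2 \<Rightarrow> real^2 \<Rightarrow> real^2 \<Rightarrow> bool" where
  "same_side a b x y \<longleftrightarrow> closed_segment x y \<inter> affine hull {a, b} = {}"

definition visible_through :: "real^2 \<Rightarrow> real^2 \<Rightarrow> real^2 \<Rightarrow> real^2 \<Rightarrow> bool" where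
  "visible_through q a b x \<longleftrightarrow> closed_segment q x \<inter> closed_segment a b \<noteq> {}"

text \<open>A polytope in the plane may be a point or a segment; a polygon may not.\<close>

definition is_convex_polygon :: "(real^2) set \<Rightarrow> bool" where
  "is_convex_polygon S \<longleftrightarrow> polytope S \<and> interior S \<noteq> {}"

text \<open>Subdivision of a region into closed pieces; adjacent pieces share boundary points, so
  disjointness is that of the interiors.\<close>

definition subdivides :: "'i set \<Rightarrow> ('i \<Rightarrow> (real^2) set) \<Rightarrow> (real^2) set \<Rightarrow> bool" where
  "subdivides I R S \<longleftrightarrow>
     (\<Union>i\<in>I. R i) = S \<and>
     (\<forall>i\<in>I. \<forall>j\<in>I. i \<noteq> j \<longrightarrow> interior (R i) \<inter> interior (R j) = {})"

end

theory Submission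
  imports Defs
begin

text \<open>Give every side \<open>i\<close> an affine function \<open>d i\<close> that vanishes on its line and is positive inside \<open>P\<close>,
  and let \<open>R i\<close> be the set of points of \<open>P\<close> where \<open>d i\<close> is the least of \<open>d 1, \<dots>, d (n-1)\<close>. These cells
  subdivide \<open>P\<close>, whatever positive factors the \<open>d i\<close> are scaled by. If \<open>d i (Q i) \<le> d j (Q i)\<close> for the
  neighbours \<open>j = i - 1, i + 1\<close> among \<open>1, \<dots>, n-1\<close>, then on a segment from \<open>R i\<close> to the triangle of
  \<open>Q i\<close> the point with \<open>d i = 0\<close> has \<open>d j \<ge> 0\<close> for both neighbours (for the base \<open>j = n\<close> because \<open>Q i\<close> is
  above it), hence lies on the side \<open>i\<close>. Such a scaling exists: a line through \<open>P (i+1)\<close> separating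
  two consecutive triangles determines an admissible ratio of the factors of \<open>d i\<close> and \<open>d (i+1)\<close>, and since
  the base carries no triangle, the ratios can be prescribed independently along the chain.\<close>

section \<open>Linear algebra in the plane and separation of convex sets\<close>

text \<open>The orthogonal complement of a nonzero plane vector is one-dimensional: the two
  orthogonality equations force the determinant of \<open>x\<close> and \<open>p\<close> to
  vanish.\<close>

lemma parallel_if_perp:
  fixes a p x :: "real^2"
  assumes "a \<noteq> 0" "p \<noteq> 0" "a \<bullet> p = 0" "a \<bullet> x = 0"
  obtains s where "x = s *\<^sub>R p"
proof -
  have a: "a$1 \<noteq> 0 \<or> a$2 \<noteq> 0" and p: "p$1 \<noteq> 0 \<or> p$2 \<noteq> 0"
    using assms(1,2) by (auto simp: vec_eq_iff forall_2)
  have e1: "a$1 * p$1 + a$2 * p$2 = 0" and e2: "a$1 * x$1 + a$2 * x$2 = 0"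
    using assms(3,4) by (simp_all add: inner_vec_def sum_2)
  have "a$1 * (x$1 * p$2 - x$2 * p$1) = 0" "a$2 * (x$1 * p$2 - x$2 * p$1) = 0"
    using e1 e2 by algebra+
  then have c: "x$1 * p$2 = x$2 * p$1" using a by auto
  show thesis
  proof (cases "p$1 = 0")
    case True
    with p c have "x = (x$2 / p$2) *\<^sub>R p" by (auto simp: vec_eq_iff forall_2)
    then show ?thesis by (rule that)
  next
    case False
    with c have "x = (x$1 / p$1) *\<^sub>R p" by (auto simp: vec_eq_iff forall_2 field_simps)
    then show ?thesis by (rule that)
  qed
qed

lemma plane_decomposition:
  fixes a p q x :: "real^2"
  assumes "p \<noteq> 0" "a \<bullet> p = 0" "a \<bullet> q \<noteq> 0"
  obtains s where "x = s *\<^sub>R p + ((a \<bullet> x) / (a \<bullet> q)) *\<^sub>R q"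
proof -
  have "a \<bullet> (x - ((a \<bullet> x) / (a \<bullet> q)) *\<^sub>R q) = 0"
    using assms(3) by (simp add: inner_diff_right)
  moreover have "a \<noteq> 0" using assms(3) by auto
  ultimately obtain s where "x - ((a \<bullet> x) / (a \<bullet> q)) *\<^sub>R q = s *\<^sub>R p"
    using parallel_if_perp assms(1,2) by metis
  then show thesis by (intro that[of s]) (simp add: algebra_simps)
qed

text \<open>Separating the interior suffices: a convex set with nonempty interior lies in the
  closure of its interior, and a closed half-space contains that closure.\<close>

lemma separating_hyperplane_interior:
  fixes S T :: "'a::euclidean_space set"
  assumes "convex S" "convex T" "interior S \<noteq> {}" "T \<noteq> {}" "interior S \<inter> T = {}"
  obtains a b where "a \<noteq> 0" "\<And>x. x \<in> S \<Longrightarrow> a \<bullet> x \<le> b" "\<And>x. x \<in> T \<Longrightarrow> a \<bullet> x \<ge> b"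
proof -
  obtain a b where a: "a \<noteq> 0" "\<forall>x\<in>interior S. a \<bullet> x \<le> b" "\<forall>x\<in>T. a \<bullet> x \<ge> b"
    using separating_hyperplane_sets[of "interior S" T] assms by auto
  have "interior S \<subseteq> {x. a \<bullet> x \<le> b}" using a(2) by auto
  then have "closure (interior S) \<subseteq> {x. a \<bullet> x \<le> b}"
    by (simp add: closed_halfspace_le closure_minimal)
  then have "S \<subseteq> {x. a \<bullet> x \<le> b}"
    using convex_closure_interior[OF assms(1,3)] closure_subset by blast
  then show thesis using a that by blast
qed

text \<open>An open set that misses \<open>interior T\<close> also misses its closure, which
  contains \<open>T\<close>.\<close>

lemma disjoint_if_disjoint_interior:
  fixes T :: "'a::euclidean_space set"
  assumes "convex T" "interior T \<noteq> {}" "open U" "U \<inter> interior T = {}"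
  shows "U \<inter> T = {}"
  using open_Int_closure_eq_empty[OF assms(3)] assms(4) closure_subset[of T]
    convex_closure_interior[OF assms(1,2)] by blast

text \<open>A convex set without interior lies in a hyperplane, which also contains \<open>m\<close>
  because it is closed. Otherwise the point \<open>m\<close> is separated from the interior.\<close>

lemma supporting_hyperplane_frontier:
  fixes S :: "'a::euclidean_space set"
  assumes "convex S" "m \<in> frontier S"
  obtains a where "a \<noteq> 0" "\<And>x. x \<in> S \<Longrightarrow> a \<bullet> m \<le> a \<bullet> x"
proof (cases "interior S = {}")
  case True
  then obtain a b where a: "a \<noteq> 0" "S \<subseteq> {x. a \<bullet> x = b}"
    using empty_interior_subset_hyperplane[OF assms(1)] by metis
  then have "closure S \<subseteq> {x. a \<bullet> x = b}" by (simp add: closed_hyperplane closure_minimal)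
  then have "a \<bullet> m = b" using assms(2) by (auto simp: frontier_def)
  then have "a \<bullet> m \<le> a \<bullet> x" if "x \<in> S" for x using a(2) that by auto
  then show ?thesis using a(1) that by blast
next
  case False
  have "interior S \<inter> {m} = {}" using assms(2) by (auto simp: frontier_def)
  then obtain a b where "a \<noteq> 0" "\<And>x. x \<in> S \<Longrightarrow> a \<bullet> x \<le> b" "a \<bullet> m \<ge> b"
    using separating_hyperplane_interior[OF assms(1) _ False, of "{m}"] by (metis convex_singleton insert_not_empty singletonI)
  then show ?thesis using that[of "- a"] by (force)
qed

lemma triangle_subset:
  "convex S \<Longrightarrow> x \<in> S \<Longrightarrow> y \<in> S \<Longrightarrow> z \<in> S \<Longrightarrow> triangle x y z \<subseteq> S"
  unfolding triangle_def by (rule hull_minimal) auto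

lemma triangle_corners: "x \<in> triangle x y z" "y \<in> triangle x y z" "z \<in> triangle x y z"
  by (auto simp: triangle_def hull_inc)

lemma convex_triangle: "convex (triangle x y z)"
  by (simp add: triangle_def)

lemma interior_triangle_nonempty:
  assumes "\<not> collinear {x, y, z}"
  shows "interior (triangle x y z) \<noteq> {}"
proof -
  have "\<not> affine_dependent {x, y, z}" "card {x, y, z} = 3"
    using assms by (auto simp: collinear_3_eq_affine_dependent)
  then show ?thesis using interior_convex_hull_eq_empty[of "{x, y, z}"] by (simp add: triangle_def)
qed

section \<open>Supporting lines of a strictly convex polygon\<close>

lemma polygon_region_vertex: "i \<in> {1..n} \<Longrightarrow> P i \<in> polygon_region n P"
  unfolding polygon_region_def by (simp add: hull_inc)

lemma cyc_succ_in: "n \<ge> 1 \<Longrightarrow> cyc_succ n i \<in> {1..n}"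
  by (simp add: cyc_succ_def Suc_leI)

lemma cyc_succ_less: "i \<in> {1..n-1} \<Longrightarrow> cyc_succ n i = i + 1"
  by (auto simp: cyc_succ_def intro!: mod_less)

lemma cyc_succ_self [simp]: "cyc_succ n n = 1"
  by (simp add: cyc_succ_def)

lemma cyc_succ_cases:
  "i \<in> {1..n} \<Longrightarrow> cyc_succ n i = (if i = n then 1 else i + 1)"
  by (auto simp: cyc_succ_def intro!: mod_less)

text \<open>A supporting line is taken at the midpoint of the side. A linear function that is
  minimal at the midpoint of a segment takes the same value at both ends, so the line contains the
  whole side.\<close>

lemma convex_polygon_side_normal:
  assumes "convex_polygon n P" "i \<in> {1..n}"
  obtains a where "a \<noteq> 0" "a \<bullet> (P (cyc_succ n i) - P i) = 0"
    "\<And>x. x \<in> polygon_region n P \<Longrightarrow> a \<bullet> (x - P i) \<ge> 0"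
proof -
  let ?s = "cyc_succ n i"
  define m where "m = midpoint (P i) (P ?s)"
  have "m \<in> side n P i" by (simp add: side_def m_def)
  then have "m \<in> frontier (polygon_region n P)"
    using assms unfolding convex_polygon_def by auto
  moreover have "convex (polygon_region n P)" by (simp add: polygon_region_def)
  ultimately obtain a where a: "a \<noteq> 0" "\<And>x. x \<in> polygon_region n P \<Longrightarrow> a \<bullet> m \<le> a \<bullet> x"
    using supporting_hyperplane_frontier by metis
  have "?s \<in> {1..n}" using assms cyc_succ_in by auto
  then have "a \<bullet> m \<le> a \<bullet> P i" "a \<bullet> m \<le> a \<bullet> P ?s"
    using a(2) polygon_region_vertex assms(2) by metis+
  moreover have "2 * (a \<bullet> m) = a \<bullet> P i + a \<bullet> P ?s"
    by (simp add: m_def midpoint_def inner_add_right)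
  ultimately have "a \<bullet> P i = a \<bullet> m" "a \<bullet> P ?s = a \<bullet> m" by linarith+
  then show thesis using a by (intro that[of a]) (auto simp: inner_diff_right)
qed

lemma angle_at_opposite:
  fixes v b :: "real^2"
  assumes "v \<noteq> 0" "s * t < 0" "a - b = t *\<^sub>R v" "c - b = s *\<^sub>R v"
  shows "angle_at a b c = pi"
proof -
  have "\<bar>t\<bar> * \<bar>s\<bar> = - (s * t)" using assms(2) by (simp add: abs_mult[symmetric] mult.commute)
  moreover have "norm (a - b) * norm (c - b) = (\<bar>t\<bar> * \<bar>s\<bar>) * (norm v)\<^sup>2"
    by (simp add: assms power2_eq_square)
  moreover have "(a - b) \<bullet> (c - b) = (s * t) * (norm v)\<^sup>2"
    by (simp add: assms power2_norm_eq_inner)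
  ultimately have "((a - b) \<bullet> (c - b)) / (norm (a - b) * norm (c - b)) = - 1"
    using assms(1,2) by (auto simp add: field_simps)
  then show ?thesis by (simp add: angle_at_def)
qed

text \<open>The quotient of \<open>s\<close> and \<open>t\<close>, with the one of smaller absolute
  value on top, is the parameter of the nearer point on the segment to the farther one.\<close>

lemma same_direction_in_segment:
  fixes v b :: "'a::real_vector"
  assumes "s * t > 0" "a - b = t *\<^sub>R v" "c - b = s *\<^sub>R v"
  shows "a \<in> closed_segment b c \<or> c \<in> closed_segment b a"
proof -
  have eq: "x \<in> closed_segment b y" if "x - b = p *\<^sub>R v" "y - b = q *\<^sub>R v" "0 \<le> p / q" "p / q \<le> 1" "q \<noteq> 0"
    for x y p q
  proof -
    have "x - b = (p / q) *\<^sub>R (y - b)" using that by simp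
    then have "x = (1 - p / q) *\<^sub>R b + (p / q) *\<^sub>R y" by (simp add: algebra_simps)
    then show ?thesis using that by (auto simp: in_segment)
  qed
  have "s \<noteq> 0" "t \<noteq> 0" "0 \<le> t / s" "0 \<le> s / t" "t / s \<le> 1 \<or> s / t \<le> 1"
    using assms(1) by (auto simp: zero_less_mult_iff divide_simps)
  then show ?thesis using eq assms by metis
qed

text \<open>The supporting line at the midpoint of either side at \<open>P m\<close> passes through \<open>P m\<close>, hence through
  \<open>P i\<close> and \<open>P j\<close>. So both neighbours of \<open>P m\<close> are on the line \<open>P i P j\<close>: on opposite sides of \<open>P m\<close>
  the angle is straight, on the same side the two sides at \<open>P m\<close> overlap.\<close>

lemma convex_polygon_no_vertex_between:
  assumes cp: "convex_polygon n P"
    and ang: "interior_angle n P m < pi"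
    and m: "m \<in> {1..n}" and ij: "i \<in> {1..n}" "j \<in> {1..n}"
  shows "P m \<notin> open_segment (P i) (P j)"
proof
  assume "P m \<in> open_segment (P i) (P j)"
  then obtain u where u: "P m = (1 - u) *\<^sub>R P i + u *\<^sub>R P j" "0 < u" "u < 1" "P i \<noteq> P j"
    by (auto simp: in_segment)
  define v where "v = P j - P i"
  have "v \<noteq> 0" using u by (simp add: v_def)
  define r where "r = (if m = 1 then n else m - 1)"
  define s where "s = cyc_succ n m"
  have n: "3 \<le> n" and inj: "inj_on P {1..n}" using cp by (auto simp: convex_polygon_def)
  have "cyc_succ n r = m"
  proof (cases "m = 1")
    case False
    then have "m - 1 \<in> {1..n-1}" using m unfolding atLeastAtMost_iff by linarith
    then show ?thesis using False m cyc_succ_less[of "m - 1" n] by (auto simp: r_def)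
  qed (simp add: r_def)
  then have r: "r \<in> {1..n}" "cyc_succ n r = m" and s: "s \<in> {1..n}" and ne: "r \<noteq> m" "s \<noteq> m" "r \<noteq> s"
    using m n cyc_succ_cases[OF m]
    by (auto simp: r_def s_def split: if_splits)
  have Pne: "P r \<noteq> P m" "P s \<noteq> P m" "P r \<noteq> P s"
    using inj ne r s m by (auto dest: inj_onD)
  \<comment> \<open>\<open>P i\<close> and \<open>P j\<close> lie on opposite sides of
    \<open>P m\<close>, so a linear function that is nonnegative towards both is constant along
    their line.\<close>
  have perp: "a \<bullet> v = 0" if "a \<bullet> (P i - P m) \<ge> 0" "a \<bullet> (P j - P m) \<ge> 0" for a
  proof -
    have "P i - P m = (- u) *\<^sub>R v" "P j - P m = (1 - u) *\<^sub>R v"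
      by (simp_all add: u v_def algebra_simps)
    then have "- u * (a \<bullet> v) \<ge> 0" "(1 - u) * (a \<bullet> v) \<ge> 0" using that by simp_all
    then show ?thesis using u by (simp add: zero_le_mult_iff mult_le_0_iff)
  qed
  obtain s' where s': "P s - P m = s' *\<^sub>R v"
  proof -
    obtain a where a: "a \<noteq> 0" "a \<bullet> (P s - P m) = 0"
      "\<And>x. x \<in> polygon_region n P \<Longrightarrow> a \<bullet> (x - P m) \<ge> 0"
      using convex_polygon_side_normal[OF cp m] s_def by metis
    then have "a \<bullet> v = 0" using perp polygon_region_vertex ij by metis
    then show thesis using parallel_if_perp a \<open>v \<noteq> 0\<close> that by metis
  qed
  obtain t' where t': "P r - P m = t' *\<^sub>R v"
  proof -
    obtain a where a: "a \<noteq> 0" "a \<bullet> (P m - P r) = 0"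
      "\<And>x. x \<in> polygon_region n P \<Longrightarrow> a \<bullet> (x - P r) \<ge> 0"
      using convex_polygon_side_normal[OF cp r(1)] r(2) by metis
    from a(2,3) have "\<And>x. x \<in> polygon_region n P \<Longrightarrow> a \<bullet> (x - P m) \<ge> 0"
      by (simp add: inner_diff_right)
    then have "a \<bullet> v = 0" using perp polygon_region_vertex ij by metis
    moreover have "a \<bullet> (P r - P m) = 0" using a(2) by (simp add: inner_diff_right)
    ultimately show thesis using parallel_if_perp a(1) \<open>v \<noteq> 0\<close> that by metis
  qed
  have "interior_angle n P m = angle_at (P r) (P m) (P s)"
    by (simp add: interior_angle_def r_def s_def)
  then have "\<not> s' * t' < 0" using angle_at_opposite[OF \<open>v \<noteq> 0\<close> _ t' s'] ang by auto
  moreover have "s' \<noteq> 0" "t' \<noteq> 0" using s' t' Pne by auto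
  ultimately have "s' * t' > 0" by (metis linorder_neqE_linordered_idom mult_eq_0_iff)
  then have "P r \<in> closed_segment (P m) (P s) \<or> P s \<in> closed_segment (P m) (P r)"
    using same_direction_in_segment t' s' by metis
  then have "P r \<in> side n P r \<inter> side n P m \<or> P s \<in> side n P r \<inter> side n P m"
    by (auto simp: side_def r(2) s_def closed_segment_commute)
  moreover have "side n P r \<inter> side n P m \<subseteq> {P r, P m} \<inter> {P m, P s}"
    using cp m r ne unfolding convex_polygon_def s_def by fastforce
  ultimately show False using Pne by auto
qed

text \<open>A further vertex on the line of side \<open>i\<close> would give three distinct
  collinear vertices, one of them strictly between the other two.\<close>

lemma strictly_convex_polygon_normal:
  assumes cp: "convex_polygon n P" and ang: "\<And>i. i \<in> {1..n} \<Longrightarrow> interior_angle n P i < pi"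
    and i: "i \<in> {1..n}"
  obtains a where "a \<bullet> (P (cyc_succ n i) - P i) = 0"
    "\<And>k. k \<in> {1..n} \<Longrightarrow> k \<noteq> i \<Longrightarrow> k \<noteq> cyc_succ n i \<Longrightarrow> a \<bullet> (P k - P i) > 0"
proof -
  define s where "s = cyc_succ n i"
  have n: "3 \<le> n" and inj: "inj_on P {1..n}" using cp by (auto simp: convex_polygon_def)
  have s: "s \<in> {1..n}" "s \<noteq> i" using i n by (auto simp: s_def cyc_succ_cases)
  obtain a where a: "a \<noteq> 0" "a \<bullet> (P s - P i) = 0"
    "\<And>x. x \<in> polygon_region n P \<Longrightarrow> a \<bullet> (x - P i) \<ge> 0"
    using convex_polygon_side_normal[OF cp i] s_def by metis
  have "a \<bullet> (P k - P i) > 0" if k: "k \<in> {1..n}" "k \<noteq> i" "k \<noteq> s" for k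
  proof (rule ccontr)
    assume "\<not> ?thesis"
    with a(3)[OF polygon_region_vertex[OF k(1)]] have 0: "a \<bullet> (P k - P i) = 0" by simp
    have ne: "P k \<noteq> P i" "P k \<noteq> P s" "P s \<noteq> P i"
      using inj k s i by (auto dest: inj_onD)
    obtain t where "P k - P i = t *\<^sub>R (P s - P i)"
      using parallel_if_perp[OF a(1) _ a(2) 0] ne by auto
    then have "collinear {P s, P i, P k}"
      by (subst collinear_3) (auto simp: collinear_lemma)
    then have "P s \<in> open_segment (P i) (P k) \<or> P i \<in> open_segment (P k) (P s)
        \<or> P k \<in> open_segment (P s) (P i)"
      using ne unfolding collinear_between_cases between_mem_segment open_segment_def by auto
    then show False using convex_polygon_no_vertex_between[OF cp ang] s i k by blast
  qed
  then show thesis using a that s_def by metis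
qed

section \<open>Affine functions of the sides\<close>

text \<open>The lengths of the normals are left free, so that every result also holds after the
  normals are multiplied by positive factors.\<close>

locale side_normals =
  fixes n :: nat and P a :: "nat \<Rightarrow> real^2"
  assumes n_ge_3: "3 \<le> n"
    and frontier_eq: "frontier (polygon_region n P) = (\<Union>i\<in>{1..n}. side n P i)"
    and normal_zero: "i \<in> {1..n} \<Longrightarrow> a i \<bullet> (P (cyc_succ n i) - P i) = 0"
    and normal_pos: "i \<in> {1..n} \<Longrightarrow> k \<in> {1..n} \<Longrightarrow> k \<noteq> i \<Longrightarrow> k \<noteq> cyc_succ n i
      \<Longrightarrow> a i \<bullet> (P k - P i) > 0"
begin

text \<open>A positive multiple of the signed distance to the line through side \<open>i\<close>, positive on the
  side of the polygon.\<close>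

definition d :: "nat \<Rightarrow> real^2 \<Rightarrow> real" where
  "d i x = a i \<bullet> (x - P i)"

abbreviation T :: "(nat \<Rightarrow> real^2) \<Rightarrow> nat \<Rightarrow> (real^2) set" where
  "T Q i \<equiv> triangle (P i) (Q i) (P (i + 1))"

lemma d_combine: "u + v = 1 \<Longrightarrow> d i (u *\<^sub>R x + v *\<^sub>R y) = u * d i x + v * d i y"
proof -
  assume "u + v = 1"
  then have "u *\<^sub>R x + v *\<^sub>R y - P i = u *\<^sub>R (x - P i) + v *\<^sub>R (y - P i)"
    by (simp add: algebra_simps flip: scaleR_left_distrib)
  then show ?thesis by (simp add: d_def inner_add_right)
qed

lemma polyhedron_d_le: "polyhedron {x. d i x \<le> d j x}"
proof -
  have "{x. d i x \<le> d j x} = {x. (a i - a j) \<bullet> x \<le> a i \<bullet> P i - a j \<bullet> P j}"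
    by (auto simp: d_def algebra_simps)
  then show ?thesis by (simp add: polyhedron_halfspace_le)
qed

lemma convex_d_le: "convex {x. d i x \<le> d j x}"
  using polyhedron_d_le polyhedron_imp_convex by blast

lemma convex_d_nonneg: "convex {x. 0 \<le> d i x}"
  and convex_d_nonpos: "convex {x. d i x \<le> 0}"
proof -
  have "{x. 0 \<le> d i x} = {x. a i \<bullet> x \<ge> a i \<bullet> P i}" "{x. d i x \<le> 0} = {x. a i \<bullet> x \<le> a i \<bullet> P i}"
    by (auto simp: d_def algebra_simps)
  then show "convex {x. 0 \<le> d i x}" "convex {x. d i x \<le> 0}"
    by (simp_all add: convex_halfspace_ge convex_halfspace_le)
qed

lemma d_self [simp]: "d i (P i) = 0"
  by (simp add: d_def)

lemma d_succ [simp]: "i \<in> {1..n-1} \<Longrightarrow> d i (P (Suc i)) = 0"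
  using normal_zero[of i] cyc_succ_less[of i n] by (auto simp: d_def)

lemma d_base [simp]: "d n (P (Suc 0)) = 0"
  using normal_zero[of n] n_ge_3 by (simp add: d_def)

lemma d_vertex_pos:
  "i \<in> {1..n-1} \<Longrightarrow> k \<in> {1..n} \<Longrightarrow> k \<noteq> i \<Longrightarrow> k \<noteq> Suc i \<Longrightarrow> d i (P k) > 0"
  using normal_pos[of i k] cyc_succ_less[of i n] by (auto simp: d_def)

lemma d_base_vertex_pos: "k \<in> {2..n-1} \<Longrightarrow> d n (P k) > 0"
  using normal_pos[of n k] n_ge_3 by (auto simp: d_def)

lemma d_vertex_nonneg: "i \<in> {1..n} \<Longrightarrow> k \<in> {1..n} \<Longrightarrow> d i (P k) \<ge> 0"
  using normal_pos[of i k] normal_zero[of i] by (force simp: d_def)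

lemma d_nonneg: "x \<in> polygon_region n P \<Longrightarrow> i \<in> {1..n} \<Longrightarrow> d i x \<ge> 0"
proof -
  assume x: "x \<in> polygon_region n P" and i: "i \<in> {1..n}"
  have "P ` {1..n} \<subseteq> {x. 0 \<le> d i x}" using d_vertex_nonneg[OF i] by blast
  then have "polygon_region n P \<subseteq> {x. 0 \<le> d i x}"
    unfolding polygon_region_def using convex_d_nonneg by (rule hull_minimal)
  then show ?thesis using x by blast
qed

text \<open>The function of the following side vanishes at \<open>P (Suc i)\<close> and is positive
  at \<open>P i\<close>; after the last side of the chain this is the base, whose function vanishes
  at \<open>P n\<close>.\<close>

lemma vertex_neq: "i \<in> {1..n-1} \<Longrightarrow> P (Suc i) \<noteq> P i"
proof
  assume i: "i \<in> {1..n-1}" and eq: "P (Suc i) = P i"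
  show False
  proof (cases "i = n - 1")
    case True
    then have "d n (P i) > 0" "P i = P n" using d_base_vertex_pos[of i] eq n_ge_3 by auto
    then show False by simp
  next
    case False
    then have "d (Suc i) (P i) > 0" using d_vertex_pos[of "Suc i" i] i by auto
    then show False using eq d_self[of "Suc i"] by simp
  qed
qed

lemma collinear_if_d_eq_0:
  assumes i: "i \<in> {1..n-1}" and 0: "d i x = 0"
  obtains s where "x - P i = s *\<^sub>R (P (Suc i) - P i)"
proof -
  \<comment> \<open>A third vertex, off the line of side \<open>i\<close>, shows that
    \<open>a i\<close> is nonzero.\<close>
  obtain k where "k \<in> {1..n}" "k \<noteq> i" "k \<noteq> Suc i"
  proof (cases "i = 1")
    case True then show ?thesis using n_ge_3 that[of 3] by auto
  next
    case False then show ?thesis using i that[of 1] by auto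
  qed
  then have "d i (P k) > 0" using d_vertex_pos i by blast
  then have "a i \<noteq> 0" by (auto simp: d_def)
  moreover have "a i \<bullet> (P (Suc i) - P i) = 0" using d_succ[OF i] by (simp add: d_def)
  ultimately show thesis
    using parallel_if_perp[of "a i" "P (Suc i) - P i" "x - P i"] vertex_neq[OF i] 0 that
    by (auto simp: d_def)
qed

definition pred :: "nat \<Rightarrow> nat" where
  "pred i = (if i = 1 then n else i - 1)"

text \<open>Along the line of side \<open>i\<close>, parametrised by \<open>s\<close> from
  \<open>P i\<close> to \<open>P (Suc i)\<close>, the function of the next side gives
  \<open>s \<le> 1\<close> and that of the preceding side gives \<open>s \<ge> 0\<close>.\<close>

lemma in_side_if:
  assumes i: "i \<in> {1..n-1}" and "d i y = 0" "d (Suc i) y \<ge> 0" "d (pred i) y \<ge> 0"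
  shows "y \<in> closed_segment (P i) (P (Suc i))"
proof -
  obtain s where s: "y - P i = s *\<^sub>R (P (Suc i) - P i)"
    using collinear_if_d_eq_0 assms by metis
  then have y: "y = (1 - s) *\<^sub>R P i + s *\<^sub>R P (Suc i)" by (simp add: algebra_simps)
  then have dy: "d j y = (1 - s) * d j (P i) + s * d j (P (Suc i))" for j
    using d_combine[of "1 - s" s j] by simp
  have "d (Suc i) (P i) > 0"
    using d_vertex_pos[of "Suc i" i] d_base_vertex_pos[of i] i n_ge_3 by (cases "i = n - 1") auto
  then have "s \<le> 1" using dy[of "Suc i"] assms(3) by (simp add: zero_le_mult_iff)
  have "d (pred i) (P i) = 0 \<and> d (pred i) (P (Suc i)) > 0"
  proof (cases "i = 1")
    case True
    then show ?thesis using d_base_vertex_pos[of "Suc i"] n_ge_3 by (auto simp: pred_def)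
  next
    case False
    then obtain j where "i = Suc j" "j \<in> {1..n-1}" using i by (cases i) auto
    then show ?thesis using d_vertex_pos[of j "Suc i"] i by (auto simp: pred_def)
  qed
  then have "s \<ge> 0" using dy[of "pred i"] assms(4) by (simp add: zero_le_mult_iff)
  show ?thesis unfolding in_segment using y \<open>s \<le> 1\<close> \<open>s \<ge> 0\<close> by blast
qed

text \<open>The vertices \<open>P 1\<close>, \<open>P 2\<close>, \<open>P 3\<close> are not
  collinear, since \<open>d 1\<close> is positive at \<open>P 3\<close>.\<close>

lemma interior_region_nonempty: "interior (polygon_region n P) \<noteq> {}"
proof
  assume "interior (polygon_region n P) = {}"
  then obtain h b where h: "h \<noteq> 0" "polygon_region n P \<subseteq> {x. h \<bullet> x = b}"
    using empty_interior_subset_hyperplane[of "polygon_region n P"]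
    by (auto simp: polygon_region_def)
  then have "h \<bullet> P k = b" if "k \<in> {1..n}" for k using polygon_region_vertex that by blast
  then have "h \<bullet> (P 2 - P 1) = 0" "h \<bullet> (P 3 - P 1) = 0"
    using n_ge_3 by (auto simp: inner_diff_right)
  moreover have "P 2 - P 1 \<noteq> 0" using vertex_neq[of 1] n_ge_3 by (auto simp: numeral_2_eq_2)
  ultimately obtain s where s: "P 3 - P 1 = s *\<^sub>R (P 2 - P 1)"
    using parallel_if_perp h(1) by metis
  have "a 1 \<bullet> (P 3 - P 1) > 0" using d_vertex_pos[of 1 3] n_ge_3 by (simp add: d_def)
  moreover have "a 1 \<bullet> (P 2 - P 1) = 0"
    using d_succ[of 1] n_ge_3 by (simp add: d_def numeral_2_eq_2)
  ultimately show False using s by simp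
qed

lemma closed_region: "closed (polygon_region n P)"
  unfolding polygon_region_def by (simp add: compact_imp_closed finite_imp_compact_convex_hull)

lemma d_pos_interior:
  assumes "S \<subseteq> {x. 0 \<le> d i x}" "a i \<noteq> 0" "x \<in> interior S"
  shows "d i x > 0"
proof -
  have "S \<subseteq> {x. a i \<bullet> x \<ge> a i \<bullet> P i}" using assms(1) by (auto simp: d_def inner_diff_right)
  then have "x \<in> interior {x. a i \<bullet> x \<ge> a i \<bullet> P i}" using assms(3) interior_mono by blast
  then show ?thesis using assms(2) by (simp add: interior_halfspace_ge d_def inner_diff_right)
qed

lemma normal_nonzero:
  assumes "d i x \<noteq> 0" shows "a i \<noteq> 0"
  using assms by (auto simp: d_def)

section \<open>Position of the apexes and ratios of the scaling factors\<close>

text \<open>A line separating the triangle from the polygon would pass through \<open>P i\<close>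
  and \<open>P (Suc i)\<close>. But \<open>q\<close> and a third vertex \<open>P k\<close> lie
  strictly on the same side of that line.\<close>

lemma triangle_meets_region:
  assumes i: "i \<in> {1..n-1}" and q: "d i q > 0"
    and int: "interior (triangle (P i) q (P (Suc i))) \<noteq> {}"
  shows "interior (triangle (P i) q (P (Suc i))) \<inter> polygon_region n P \<noteq> {}"
proof
  let ?U = "interior (triangle (P i) q (P (Suc i)))"
  assume "?U \<inter> polygon_region n P = {}"
  moreover have "convex (polygon_region n P)" by (simp add: polygon_region_def)
  moreover have V: "P k \<in> polygon_region n P" if "k \<in> {1..n}" for k
    using polygon_region_vertex that by blast
  then have "polygon_region n P \<noteq> {}" using i by force
  ultimately obtain h b where h: "h \<noteq> 0"
    "\<And>x. x \<in> triangle (P i) q (P (Suc i)) \<Longrightarrow> h \<bullet> x \<le> b"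
    "\<And>x. x \<in> polygon_region n P \<Longrightarrow> h \<bullet> x \<ge> b"
    using separating_hyperplane_interior[OF convex_triangle _ int] by metis
  have "h \<bullet> P i = b" "h \<bullet> P (Suc i) = b"
    using h(2,3) V[of i] V[of "Suc i"] triangle_corners i by (auto intro!: antisym)
  then have perp: "h \<bullet> (P (Suc i) - P i) = 0" by (simp add: inner_diff_right)
  obtain k where k: "k \<in> {1..n}" "k \<noteq> i" "k \<noteq> Suc i"
  proof (cases "i = 1")
    case True then show ?thesis using n_ge_3 that[of 3] by auto
  next
    case False then show ?thesis using i that[of 1] by auto
  qed
  then have dk: "d i (P k) > 0" using d_vertex_pos i by blast
  have ne: "P (Suc i) - P i \<noteq> 0" using vertex_neq i by simp
  have ai: "a i \<bullet> (P (Suc i) - P i) = 0" using d_succ[OF i] by (simp add: d_def)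
  have aq: "a i \<bullet> (q - P i) > 0" using q by (simp add: d_def)
  \<comment> \<open>Decomposing along the side, where \<open>h\<close> vanishes, shows that
    \<open>h\<close> is a multiple of \<open>a i\<close>.\<close>
  have dec: "h \<bullet> x = (a i \<bullet> x) / (a i \<bullet> (q - P i)) * (h \<bullet> (q - P i))" for x
  proof -
    obtain s where s: "x = s *\<^sub>R (P (Suc i) - P i)
        + ((a i \<bullet> x) / (a i \<bullet> (q - P i))) *\<^sub>R (q - P i)"
      using plane_decomposition[OF ne ai, of "q - P i" x] aq by auto
    show ?thesis using arg_cong[OF s, of "\<lambda>y. h \<bullet> y"] perp
      by (simp add: inner_add_right del: inner_diff_right)
  qed
  have "h \<bullet> (q - P i) \<le> 0" using h(2)[of q] triangle_corners \<open>h \<bullet> P i = b\<close>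
    by (simp add: inner_diff_right)
  moreover have "h \<bullet> (P k - P i) \<ge> 0" using h(3) V k \<open>h \<bullet> P i = b\<close> by (simp add: inner_diff_right)
  ultimately have "h \<bullet> (q - P i) = 0"
    using dec[of "P k - P i"] dk aq by (simp add: d_def zero_le_mult_iff zero_le_divide_iff)
  then have "h \<bullet> h = 0" using dec[of h] by simp
  then show False using h(1) by simp
qed

text \<open>If the apex were on the inner side, the triangle would leave the polygon through a side \<open>j\<close>
  other than \<open>i\<close> and \<open>n\<close> and overlap the triangle erected there.\<close>

lemma apex_outside:
  assumes i: "i \<in> {1..n-1}"
    and out: "Q i \<notin> polygon_region n P"
    and ncol: "\<And>j. j \<in> {1..n-1} \<Longrightarrow> \<not> collinear {P j, Q j, P (j+1)}"
    and disj: "\<And>j. j \<in> {1..n-1} \<Longrightarrow> i \<noteq> j \<Longrightarrow> interior (T Q i) \<inter> interior (T Q j) = {}"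
    and base: "d n (Q i) > 0"
  shows "d i (Q i) < 0"
proof (rule ccontr)
  assume "\<not> d i (Q i) < 0"
  moreover have "d i (Q i) \<noteq> 0"
  proof
    assume "d i (Q i) = 0"
    then obtain s where "Q i - P i = s *\<^sub>R (P (Suc i) - P i)" using collinear_if_d_eq_0 i by metis
    then have "collinear {P (Suc i), P i, Q i}"
      by (subst collinear_3) (auto simp: collinear_lemma)
    then show False using ncol[OF i] by (simp add: insert_commute)
  qed
  ultimately have q: "d i (Q i) > 0" by simp
  let ?C = "polygon_region n P" and ?U = "interior (T Q i)"
  have int: "interior (T Q j) \<noteq> {}" if "j \<in> {1..n-1}" for j
    using interior_triangle_nonempty ncol that by blast
  have "?U \<inter> ?C \<noteq> {}" using triangle_meets_region[OF i q] int[OF i] by simp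
  \<comment> \<open>The apex is in the closure of \<open>?U\<close> and in the open complement of
    \<open>?C\<close>, so points of \<open>?U\<close> near it are outside the polygon.\<close>
  moreover have "?U - ?C \<noteq> {}"
  proof -
    have "Q i \<in> closure ?U"
      using convex_closure_interior[OF convex_triangle int[OF i]] triangle_corners closure_subset by blast
    then have "(- ?C) \<inter> ?U \<noteq> {}"
      using open_Int_closure_eq_empty[of "- ?C" ?U] closed_region out by auto
    then show ?thesis by auto
  qed
  moreover have "connected ?U" by (simp add: convex_connected convex_interior convex_triangle)
  ultimately obtain y where y: "y \<in> ?U" "y \<in> frontier ?C"
    using connected_Int_frontier by blast
  then obtain j where j: "j \<in> {1..n}" "y \<in> side n P j" using frontier_eq by auto
  have "T Q i \<subseteq> {x. 0 \<le> d i x}"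
    using i q by (intro triangle_subset convex_d_nonneg) auto
  then have di: "d i y > 0" using d_pos_interior y q normal_nonzero by (metis less_irrefl)
  have "T Q i \<subseteq> {x. 0 \<le> d n x}"
    using i base d_vertex_nonneg[of n i] d_vertex_nonneg[of n "i + 1"]
    by (intro triangle_subset convex_d_nonneg) auto
  then have dn: "d n y > 0" using d_pos_interior y base normal_nonzero by (metis less_irrefl)
  obtain u where u: "y = (1 - u) *\<^sub>R P j + u *\<^sub>R P (cyc_succ n j)"
    using j(2) by (auto simp: side_def in_segment)
  have "d j (P (cyc_succ n j)) = 0" using normal_zero j(1) by (simp add: d_def)
  then have "d j y = 0" using u d_combine[of "1 - u" u j] by simp
  then have jne: "j \<noteq> i" "j \<noteq> n" using di dn by auto
  then have j': "j \<in> {1..n-1}" using j(1) by auto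
  have "y \<in> T Q j"
    using j(2) closed_segment_subset[OF triangle_corners(1) triangle_corners(3) convex_triangle]
      cyc_succ_less[OF j'] by (auto simp: side_def)
  \<comment> \<open>The point \<open>y\<close> is on the boundary of the triangle \<open>j\<close>;
    since \<open>?U\<close> is open, disjoint interiors exclude such points too.\<close>
  moreover have "?U \<inter> T Q j = {}"
    using disjoint_if_disjoint_interior[OF convex_triangle int[OF j'] _ disj] j' jne by auto
  ultimately show False using y by auto
qed

text \<open>A line separating the two triangles passes through \<open>P (i+1)\<close>, so it is the zero set of
  \<open>l * d i - m * d (i+1)\<close> with \<open>l, m \<ge> 0\<close>, and \<open>m / l\<close> is the required ratio unless the line contains
  one of the two sides.\<close>

lemma weight_ratio:
  assumes i: "i \<in> {1..n-1}" "i + 1 \<in> {1..n-1}"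
    and ncol: "\<not> collinear {P i, Q i, P (i+1)}" "\<not> collinear {P (i+1), Q (i+1), P (i+2)}"
    and disj: "interior (T Q i) \<inter> interior (T Q (i+1)) = {}"
    and neg: "d i (Q i) < 0" "d (i+1) (Q (i+1)) < 0"
  shows "\<exists>r>0. d i (Q i) \<le> r * d (i+1) (Q i) \<and> r * d (i+1) (Q (i+1)) \<le> d i (Q (i+1))"
proof -
  have int: "interior (T Q i) \<noteq> {}" "interior (T Q (i+1)) \<noteq> {}"
    using interior_triangle_nonempty ncol by (auto simp: numeral_2_eq_2)
  have "interior (T Q i) \<inter> T Q (i+1) = {}"
    using disjoint_if_disjoint_interior[OF convex_triangle int(2) _ disj] by simp
  then obtain h b where h: "h \<noteq> 0" "\<And>x. x \<in> T Q i \<Longrightarrow> h \<bullet> x \<le> b" "\<And>x. x \<in> T Q (i+1) \<Longrightarrow> h \<bullet> x \<ge> b"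
    using separating_hyperplane_interior[OF convex_triangle convex_triangle int(1)]
      triangle_corners(1) by (metis empty_iff)
  define p q where "p = P i - P (i+1)" and "q = P (i+2) - P (i+1)"
  define A B where "A = d (i+1) (P i)" and "B = d i (P (i+2))"
  have AB: "A > 0" "B > 0"
    using d_vertex_pos[of "i+1" i] d_vertex_pos[of i "i+2"] i by (auto simp: A_def B_def)
  have b: "h \<bullet> P (i+1) = b"
    using h(2)[OF triangle_corners(3)] h(3)[OF triangle_corners(1)] by simp
  have zero: "a i \<bullet> p = 0" "a (i+1) \<bullet> q = 0"
    using d_succ[of i] d_succ[of "i+1"] i by (auto simp: d_def p_def q_def inner_diff_right)
  have di: "d i x = a i \<bullet> (x - P (i+1))" for x
    using zero(1) by (simp add: d_def p_def inner_diff_right)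
  have aB: "a i \<bullet> q = B" "a (i+1) \<bullet> p = A" by (simp add: B_def di q_def) (simp add: A_def d_def p_def)
  \<comment> \<open>These are the coordinates of \<open>h\<close> with respect to \<open>a i\<close>
    and \<open>- a (i+1)\<close>: since \<open>a i\<close> vanishes on \<open>p\<close> and
    \<open>a (i+1)\<close> on \<open>q\<close>, they are read off at \<open>q\<close> and
    \<open>p\<close>.\<close>
  define l m where "l = h \<bullet> q / B" and "m = - (h \<bullet> p / A)"
  have dec: "h \<bullet> x - b = l * d i x - m * d (i+1) x" for x
  proof -
    have "p \<noteq> 0" using vertex_neq[OF i(1)] by (auto simp: p_def)
    then obtain s where s: "x - P (i+1) = s *\<^sub>R p + ((a i \<bullet> (x - P (i+1))) / (a i \<bullet> q)) *\<^sub>R q"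
      using plane_decomposition[of p "a i" q "x - P (i+1)"] zero aB AB by auto
    then have s': "x - P (i+1) = s *\<^sub>R p + (d i x / B) *\<^sub>R q" by (simp add: di aB)
    have "d (i+1) x = s * A" unfolding d_def s' using zero(2) aB(2) by (simp add: inner_add_right)
    moreover have "h \<bullet> (x - P (i+1)) = s * (h \<bullet> p) + d i x / B * (h \<bullet> q)"
      unfolding s' by (simp add: inner_add_right)
    ultimately show ?thesis using AB b by (simp add: inner_diff_right l_def m_def)
  qed
  have "h \<bullet> p \<le> 0" "h \<bullet> q \<ge> 0"
    using h(2)[OF triangle_corners(1)] h(3)[OF triangle_corners(3)] b
    by (auto simp: p_def q_def inner_diff_right numeral_2_eq_2)
  then have lm: "l \<ge> 0" "m \<ge> 0" using AB by (auto simp: l_def m_def divide_nonpos_pos)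
  have "\<not> (l = 0 \<and> m = 0)"
  proof
    assume "l = 0 \<and> m = 0"
    then have "h \<bullet> x = b" for x using dec[of x] by simp
    from this[of 0] this[of h] show False using h(1) by simp
  qed
  moreover have 1: "l * d i (Q i) \<le> m * d (i+1) (Q i)"
    using h(2)[OF triangle_corners(2)] dec[of "Q i"] by simp
  moreover have 2: "m * d (i+1) (Q (i+1)) \<le> l * d i (Q (i+1))"
    using h(3)[OF triangle_corners(2)] dec[of "Q (i+1)"] by simp
  ultimately consider "l > 0" "m > 0" | "l = 0" "m > 0" | "l > 0" "m = 0" using lm by force
  then show ?thesis
  proof cases
    case 1
    then show ?thesis using \<open>l * _ \<le> _\<close> \<open>m * _ \<le> _\<close>
      by (intro exI[of _ "m / l"]) (simp add: field_simps)
  next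
    case 2
    then have "d (i+1) (Q i) \<ge> 0" using 1 by (simp add: zero_le_mult_iff)
    \<comment> \<open>The separating line contains side \<open>i+1\<close>. The first inequality
      then holds for every positive \<open>r\<close>, and the second one for every large enough
      \<open>r\<close>.\<close>
    define r where "r = max 1 (d i (Q (i+1)) / d (i+1) (Q (i+1)))"
    have "r > 0" by (simp add: r_def)
    moreover have "r * d (i+1) (Q (i+1)) \<le> d i (Q (i+1))"
      using neg(2) by (simp add: r_def max_def field_simps)
    moreover have "r * d (i+1) (Q i) \<ge> 0" using \<open>r > 0\<close> \<open>d (i+1) (Q i) \<ge> 0\<close> by simp
    ultimately show ?thesis using neg(1) by (intro exI[of _ r]) linarith
  next
    case 3
    then have "d i (Q (i+1)) \<ge> 0" using 2 by (simp add: zero_le_mult_iff)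
    \<comment> \<open>The separating line contains side \<open>i\<close>. Now the second inequality
      holds for every positive \<open>r\<close>, and the first one needs \<open>r\<close> small; the
      added 1 keeps the denominator positive.\<close>
    define D where "D = \<bar>d (i+1) (Q i)\<bar> + 1"
    define r where "r = - d i (Q i) / D"
    have "D > 0" by (simp add: D_def)
    then have "r > 0" using neg by (simp add: r_def divide_neg_pos)
    have "- D \<le> d (i+1) (Q i)" by (simp add: D_def)
    then have "r * (- D) \<le> r * d (i+1) (Q i)" using \<open>r > 0\<close> by (intro mult_left_mono) auto
    moreover have "r * (- D) = d i (Q i)" using \<open>D > 0\<close> by (simp add: r_def)
    moreover have "r * d (i+1) (Q (i+1)) \<le> 0" using \<open>r > 0\<close> neg by (simp add: mult_nonneg_nonpos)
    ultimately show ?thesis using \<open>r > 0\<close> \<open>d i (Q (i+1)) \<ge> 0\<close> by (intro exI[of _ r]) linarith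
  qed
qed

text \<open>The test point is \<open>P 2\<close>, where \<open>d n\<close> is positive. If
  \<open>d n q\<close> were not positive, \<open>d n\<close> would have a zero on the segment from
  \<open>q\<close> to \<open>P 2\<close>, which would then meet the base line.\<close>

lemma base_pos:
  assumes same: "\<And>x. x \<in> polygon_region n P - affine hull {P 1, P n} \<Longrightarrow> same_side (P 1) (P n) q x"
  shows "d n q > 0"
proof (rule ccontr)
  assume neg: "\<not> d n q > 0"
  have pos: "d n (P 2) > 0" using d_base_vertex_pos[of 2] n_ge_3 by simp
  have hull: "affine hull {P 1, P n} = {x. d n x = 0}"
  proof
    have "{x. d n x = 0} = {x. a n \<bullet> x = a n \<bullet> P n}" by (auto simp: d_def inner_diff_right)
    then have "affine {x. d n x = 0}" by (simp add: affine_hyperplane)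
    then show "affine hull {P 1, P n} \<subseteq> {x. d n x = 0}" by (intro hull_minimal) auto
    show "{x. d n x = 0} \<subseteq> affine hull {P 1, P n}"
    proof
      fix x assume "x \<in> {x. d n x = 0}"
      then have x: "a n \<bullet> (x - P n) = 0" by (simp add: d_def)
      have "d 1 (P n) > 0" using d_vertex_pos[of 1 n] n_ge_3 by simp
      then have "P 1 - P n \<noteq> 0" using d_self[of 1] by (metis eq_iff_diff_eq_0 less_irrefl)
      moreover have "a n \<bullet> (P 1 - P n) = 0" using d_base by (simp add: d_def)
      moreover have "a n \<noteq> 0" using pos by (auto simp: d_def)
      ultimately obtain s where "x - P n = s *\<^sub>R (P 1 - P n)"
        using parallel_if_perp x by metis
      then have "x = s *\<^sub>R P 1 + (1 - s) *\<^sub>R P n" by (simp add: algebra_simps)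
      then show "x \<in> affine hull {P 1, P n}" unfolding affine_hull_2 by force
    qed
  qed
  have "P 2 \<in> polygon_region n P - affine hull {P 1, P n}"
    using polygon_region_vertex[of 2 n P] n_ge_3 pos hull by auto
  then have disj: "closed_segment q (P 2) \<inter> {x. d n x = 0} = {}"
    using same hull by (simp add: same_side_def)
  define u where "u = d n q / (d n q - d n (P 2))"
  have u: "0 \<le> u" "u \<le> 1" using pos neg by (auto simp: u_def divide_nonpos_neg field_simps)
  have "(1 - u) * d n q + u * d n (P 2) = 0" using pos neg by (simp add: u_def field_simps)
  then have "d n ((1 - u) *\<^sub>R q + u *\<^sub>R P 2) = 0" using d_combine[of "1 - u" u n] by simp
  moreover have "(1 - u) *\<^sub>R q + u *\<^sub>R P 2 \<in> closed_segment q (P 2)"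
    using u by (auto simp: in_segment)
  ultimately show False using disj by blast
qed

lemma scaled_normals:
  assumes "\<And>i. i \<in> {1..n} \<Longrightarrow> c i > 0"
  shows "side_normals n P (\<lambda>i. c i *\<^sub>R a i)"
  using n_ge_3 frontier_eq normal_zero normal_pos assms by unfold_locales auto

end

section \<open>The cells for a balanced scaling\<close>

text \<open>Each apex is compared with the adjacent sides of the chain only, because
  \<open>in_side_if\<close> tests a point only against the two neighbours of a side.\<close>

locale balanced_normals = side_normals +
  fixes Q :: "nat \<Rightarrow> real^2"
  assumes apex_neg: "i \<in> {1..n-1} \<Longrightarrow> d i (Q i) < 0"
    and apex_base: "i \<in> {1..n-1} \<Longrightarrow> d n (Q i) > 0"
    and balance: "i \<in> {1..n-2} \<Longrightarrow> d i (Q i) \<le> d (i+1) (Q i)"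
      "i \<in> {1..n-2} \<Longrightarrow> d (i+1) (Q (i+1)) \<le> d i (Q (i+1))"
begin

definition cell :: "nat \<Rightarrow> (real^2) set" where
  "cell i = polygon_region n P \<inter> (\<Inter>j\<in>{1..n-1}. {x. d i x \<le> d j x})"

text \<open>The point \<open>z\<close> ranges over the whole triangle: the apex gives visibility,
  and the other points give convexity of the union.\<close>

lemma cell_cross:
  assumes i: "i \<in> {1..n-1}" and x: "x \<in> cell i" and z: "z \<in> T Q i"
  obtains y where "y \<in> closed_segment x z" "y \<in> closed_segment (P i) (P (i+1))"
proof -
  have i1: "i \<in> {1..n}" "Suc i \<in> {1..n}" using i by auto
  have xC: "x \<in> polygon_region n P" using x by (simp add: cell_def)
  have dx: "d i x \<ge> 0" using d_nonneg[OF xC i1(1)] .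
  have "T Q i \<subseteq> {z. d i z \<le> 0}"
    using i apex_neg[OF i] by (intro triangle_subset convex_d_nonpos) auto
  then have dz: "d i z \<le> 0" using z by auto
  \<comment> \<open>This is the zero of \<open>d i\<close> between \<open>x\<close> and
    \<open>z\<close>. The case split avoids a zero denominator when both ends are on the line of the
    side.\<close>
  obtain u where u: "0 \<le> u" "u \<le> 1" "(1 - u) * d i x + u * d i z = 0"
  proof (cases "d i x = 0")
    case True
    then show ?thesis using that[of 0] by simp
  next
    case False
    then have "d i x - d i z > 0" using dx dz by linarith
    then show ?thesis using dx dz
      by (intro that[of "d i x / (d i x - d i z)"]) (auto simp: field_simps)
  qed
  define y where "y = (1 - u) *\<^sub>R x + u *\<^sub>R z"
  have dy: "d j y = (1 - u) * d j x + u * d j z" for j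
    using d_combine[of "1 - u" u j] by (simp add: y_def)
  have diy: "d i y = 0" using dy u by simp
  \<comment> \<open>The comparison of \<open>d i\<close> with \<open>d j\<close> extends from the
    corners to the triangle: at \<open>P i\<close> and \<open>P (Suc i)\<close> it holds because
    \<open>d i\<close> vanishes there, at \<open>Q i\<close> by assumption.\<close>
  have neighbour: "d j y \<ge> 0" if j: "j \<in> {1..n-1}" "d i (Q i) \<le> d j (Q i)" for j
  proof -
    have "T Q i \<subseteq> {z. d i z \<le> d j z}"
      using i j i1 d_vertex_nonneg[of j i] d_vertex_nonneg[of j "Suc i"]
      by (intro triangle_subset convex_d_le) auto
    then have "d i z \<le> d j z" using z by auto
    moreover have "d i x \<le> d j x" using x j by (auto simp: cell_def)
    ultimately have "d i y \<le> d j y" unfolding dy using u by (intro add_mono mult_left_mono) auto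
    then show ?thesis using diy by simp
  qed
  have base: "d n y \<ge> 0"
  proof -
    have "T Q i \<subseteq> {z. 0 \<le> d n z}"
      using i i1 apex_base[OF i] d_vertex_nonneg[of n i] d_vertex_nonneg[of n "Suc i"]
      by (intro triangle_subset convex_d_nonneg) auto
    then have "0 \<le> d n z" using z by auto
    moreover have "0 \<le> d n x" using d_nonneg[OF xC] n_ge_3 by simp
    ultimately show ?thesis unfolding dy using u by simp
  qed
  \<comment> \<open>For the last side the next neighbour is the base, and likewise below for the
    predecessor of the first side; there \<open>base\<close> replaces the balance condition.\<close>
  have "d (Suc i) y \<ge> 0"
  proof (cases "i = n - 1")
    case True then show ?thesis using base n_ge_3 by simp
  next
    case False
    then have "i \<in> {1..n-2}" "Suc i \<in> {1..n-1}" using i unfolding atLeastAtMost_iff by linarith+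
    then show ?thesis using neighbour balance(1)[of i] by simp
  qed
  moreover have "d (pred i) y \<ge> 0"
  proof (cases "i = 1")
    case True then show ?thesis using base by (simp add: pred_def)
  next
    case False
    then have *: "i - 1 \<in> {1..n-2}" "i - 1 \<in> {1..n-1}" "i - 1 + 1 = i"
      using i unfolding atLeastAtMost_iff by linarith+
    then show ?thesis using neighbour[of "i - 1"] balance(2)[of "i - 1"] False
      by (simp add: pred_def)
  qed
  ultimately have "y \<in> closed_segment (P i) (P (i+1))"
    using in_side_if[OF i diy] by simp
  moreover have "y \<in> closed_segment x z" using u y_def by (auto simp: in_segment)
  ultimately show thesis using that by blast
qed

lemma polytope_cell: "polytope (cell i)"
proof -
  have "polytope (polygon_region n P)"
    by (simp add: polygon_region_def polytope_convex_hull)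
  moreover have "polyhedron (\<Inter>j\<in>{1..n-1}. {x. d i x \<le> d j x})"
    using polyhedron_d_le by (intro polyhedron_Inter) auto
  ultimately show ?thesis unfolding cell_def by (rule polytope_Int_polyhedron)
qed

lemma side_subset_cell:
  assumes i: "i \<in> {1..n-1}"
  shows "closed_segment (P i) (P (i+1)) \<subseteq> cell i"
proof (rule closed_segment_subset)
  have i1: "i \<in> {1..n}" "Suc i \<in> {1..n}" using i by auto
  then show "P i \<in> cell i" "P (i+1) \<in> cell i"
    using i by (auto simp: cell_def polygon_region_vertex d_vertex_nonneg)
  show "convex (cell i)" using polytope_cell polytope_imp_convex by blast
qed

text \<open>A segment from the cell to the triangle is cut at its crossing point with side
  \<open>i\<close>. This point belongs to both convex sets, so each half stays in one of
  them.\<close>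

lemma convex_cell_Un:
  assumes i: "i \<in> {1..n-1}"
  shows "convex (cell i \<union> T Q i)"
proof -
  have cell: "convex (cell i)" using polytope_cell polytope_imp_convex by blast
  have mixed: "closed_segment x z \<subseteq> cell i \<union> T Q i" if xz: "x \<in> cell i" "z \<in> T Q i" for x z
  proof -
    obtain y where y: "y \<in> closed_segment x z" "y \<in> closed_segment (P i) (P (i+1))"
      using cell_cross[OF i xz] .
    have "y \<in> cell i" using y side_subset_cell[OF i] by blast
    moreover have "y \<in> T Q i"
      using y(2) closed_segment_subset[OF triangle_corners(1) triangle_corners(3) convex_triangle] by blast
    moreover have "closed_segment x z = closed_segment x y \<union> closed_segment y z"
      using Un_closed_segment y(1) by metis
    ultimately show ?thesis
      using xz closed_segment_subset[OF _ _ cell] closed_segment_subset[OF _ _ convex_triangle] by blast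
  qed
  show ?thesis
    unfolding convex_contains_segment
    using mixed closed_segment_commute closed_segment_subset[OF _ _ cell]
      closed_segment_subset[OF _ _ convex_triangle] by (metis UnE le_supI1 le_supI2)
qed

lemma d_midpoint: "d j (midpoint x y) = (d j x + d j y) / 2"
  using d_combine[of "1/2" "1/2" j x y] by (simp add: midpoint_def scaleR_right_distrib)

text \<open>Two different sides share at most one vertex, so \<open>d j\<close> is positive at one
  end of side \<open>i\<close> at least.\<close>

lemma d_midpoint_pos:
  assumes "i \<in> {1..n-1}" "j \<in> {1..n-1}" "j \<noteq> i"
  shows "d j (midpoint (P i) (P (Suc i))) > 0"
proof -
  have "d j (midpoint (P i) (P (Suc i))) = (d j (P i) + d j (P (Suc i))) / 2"
    by (rule d_midpoint)
  moreover have "d j (P i) \<ge> 0" "d j (P (Suc i)) \<ge> 0"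
    using assms by (auto intro!: d_vertex_nonneg)
  moreover have "d j (P i) > 0 \<or> d j (P (Suc i)) > 0"
    using assms d_vertex_pos[of j i] d_vertex_pos[of j "Suc i"] by (cases "i = Suc j") auto
  ultimately show ?thesis by (auto intro: add_pos_nonneg add_nonneg_pos)
qed

lemma d_midpoint_self: "i \<in> {1..n-1} \<Longrightarrow> d i (midpoint (P i) (P (Suc i))) = 0"
  using d_midpoint[of i "P i" "P (Suc i)"] by simp

text \<open>At the midpoint of side \<open>i\<close>, \<open>d i\<close> is strictly the least of
  the functions. This persists in a neighbourhood, which contains interior points of the
  polygon.\<close>

lemma interior_cell_nonempty:
  assumes i: "i \<in> {1..n-1}"
  shows "interior (cell i) \<noteq> {}"
proof -
  let ?C = "polygon_region n P" and ?m = "midpoint (P i) (P (Suc i))"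
  define V where "V = (\<Inter>j\<in>{1..n-1} - {i}. {x. d i x < d j x})"
  have "open V"
    unfolding V_def d_def by (intro open_INT ballI open_Collect_less continuous_intros) auto
  moreover have "?m \<in> V"
    using d_midpoint_pos d_midpoint_self i by (auto simp: V_def)
  moreover have "?m \<in> ?C"
    using side_subset_cell[OF i] midpoint_in_closed_segment[of "P i" "P (Suc i)"]
    by (auto simp: cell_def)
  then have "?m \<in> closure (interior ?C)"
    using convex_closure_interior[OF _ interior_region_nonempty] closure_subset
    by (auto simp: polygon_region_def)
  ultimately have "V \<inter> interior ?C \<noteq> {}" using open_Int_closure_eq_empty[of V] by blast
  moreover have "V \<inter> interior ?C \<subseteq> cell i"
  proof
    fix x assume x: "x \<in> V \<inter> interior ?C"
    then have "d i x \<le> d j x" if "j \<in> {1..n-1}" for j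
      using that by (cases "j = i") (auto simp: V_def intro: less_imp_le)
    then show "x \<in> cell i" using x interior_subset by (auto simp: cell_def)
  qed
  then have "V \<inter> interior ?C \<subseteq> interior (cell i)"
    using \<open>open V\<close> by (intro interior_maximal) auto
  ultimately show ?thesis by blast
qed

text \<open>Common points satisfy \<open>d i x = d j x\<close>. This equation describes a genuine
  line, since the difference has opposite signs at the midpoints of the two sides.\<close>

lemma interior_cells_disjoint:
  assumes ij: "i \<in> {1..n-1}" "j \<in> {1..n-1}" "i \<noteq> j"
  shows "interior (cell i) \<inter> interior (cell j) = {}"
proof -
  let ?b = "a i \<bullet> P i - a j \<bullet> P j"
  have diff: "d i x - d j x = (a i - a j) \<bullet> x - ?b" for x
    by (simp add: d_def algebra_simps)
  have "a i \<noteq> a j"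
    using diff[of "midpoint (P i) (P (Suc i))"] diff[of "midpoint (P j) (P (Suc j))"]
      d_midpoint_pos[of i j] d_midpoint_pos[of j i] d_midpoint_self ij by auto
  have "cell i \<inter> cell j \<subseteq> {x. (a i - a j) \<bullet> x = ?b}"
  proof
    fix x assume "x \<in> cell i \<inter> cell j"
    then have "d i x = d j x" using ij by (auto simp: cell_def intro: antisym)
    then show "x \<in> {x. (a i - a j) \<bullet> x = ?b}" using diff[of x] by simp
  qed
  then have "interior (cell i \<inter> cell j) \<subseteq> interior {x. (a i - a j) \<bullet> x = ?b}"
    by (rule interior_mono)
  then show ?thesis using \<open>a i \<noteq> a j\<close> by (simp add: interior_hyperplane)
qed

lemma Union_cells: "(\<Union>i\<in>{1..n-1}. cell i) = polygon_region n P"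
proof
  show "polygon_region n P \<subseteq> (\<Union>i\<in>{1..n-1}. cell i)"
  proof
    fix x assume x: "x \<in> polygon_region n P"
    obtain i where "i \<in> {1..n-1}" "\<forall>j\<in>{1..n-1}. d i x \<le> d j x"
      using ex_min_if_finite[of "(\<lambda>i. d i x) ` {1..n-1}"] n_ge_3
      by (fastforce simp: not_less)
    then show "x \<in> (\<Union>i\<in>{1..n-1}. cell i)" using x by (auto simp: cell_def)
  qed
qed (auto simp: cell_def)

end

section \<open>Choice of the normals and of their scaling\<close>

theorem theorem5:
  fixes n :: nat and P Q :: "nat \<Rightarrow> real^2"
  assumes "convex_polygon n P"
    and "\<And>i. i \<in> {1..n} \<Longrightarrow> interior_angle n P i < pi"
    and "\<And>i. i \<in> {1..n-1} \<Longrightarrow> Q i \<notin> polygon_region n P"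
    and "\<And>i. i \<in> {1..n-1} \<Longrightarrow> \<not> collinear {P i, Q i, P (i+1)}"
    and "\<And>i j. i \<in> {1..n-1} \<Longrightarrow> j \<in> {1..n-1} \<Longrightarrow> i \<noteq> j \<Longrightarrow>
           interior (triangle (P i) (Q i) (P (i+1))) \<inter>
           interior (triangle (P j) (Q j) (P (j+1))) = {}"
    and "\<And>i x. i \<in> {1..n-1} \<Longrightarrow> x \<in> polygon_region n P - affine hull {P 1, P n} \<Longrightarrow>
           same_side (P 1) (P n) (Q i) x"
  shows "\<exists>R :: nat \<Rightarrow> (real^2) set.
           (\<forall>i\<in>{1..n-1}. R i = {} \<or> is_convex_polygon (R i)) \<and>
           subdivides {1..n-1} R (polygon_region n P) \<and>
           (\<forall>i\<in>{1..n-1}.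
              (\<forall>x\<in>R i. visible_through (Q i) (P i) (P (i+1)) x) \<and>
              convex (R i \<union> triangle (P i) (Q i) (P (i+1))))"
proof -
  have "\<forall>i\<in>{1..n}. \<exists>a. a \<bullet> (P (cyc_succ n i) - P i) = 0 \<and>
      (\<forall>k\<in>{1..n}. k \<noteq> i \<longrightarrow> k \<noteq> cyc_succ n i \<longrightarrow> a \<bullet> (P k - P i) > 0)"
    using strictly_convex_polygon_normal[OF assms(1,2)] by metis
  then obtain a where a: "\<forall>i\<in>{1..n}. a i \<bullet> (P (cyc_succ n i) - P i) = 0 \<and>
      (\<forall>k\<in>{1..n}. k \<noteq> i \<longrightarrow> k \<noteq> cyc_succ n i \<longrightarrow> a i \<bullet> (P k - P i) > 0)"
    by metis
  interpret A: side_normals n P a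
    using assms(1) a unfolding convex_polygon_def by unfold_locales auto
  have n: "3 \<le> n" by (rule A.n_ge_3)
  have base: "A.d n (Q i) > 0" if i: "i \<in> {1..n-1}" for i
  proof (rule A.base_pos)
    show "\<And>x. x \<in> polygon_region n P - affine hull {P 1, P n} \<Longrightarrow> same_side (P 1) (P n) (Q i) x"
      using assms(6)[OF i] .
  qed
  have neg: "A.d i (Q i) < 0" if i: "i \<in> {1..n-1}" for i
    using A.apex_outside[OF i assms(3)[OF i] assms(4)] assms(5)[OF i] base[OF i] by blast
  have "\<exists>r>0. A.d i (Q i) \<le> r * A.d (i+1) (Q i) \<and> r * A.d (i+1) (Q (i+1)) \<le> A.d i (Q (i+1))"
    if i: "i \<in> {1..n-2}" for i
  proof -
    have i': "i \<in> {1..n-1}" "i + 1 \<in> {1..n-1}" using i n unfolding atLeastAtMost_iff by linarith+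
    then show ?thesis
      using A.weight_ratio[OF i'] assms(4)[OF i'(1)] assms(4)[OF i'(2)] assms(5)[OF i'] neg by simp
  qed
  then obtain r where r: "\<And>i. i \<in> {1..n-2} \<Longrightarrow> r i > 0 \<and>
      A.d i (Q i) \<le> r i * A.d (i+1) (Q i) \<and> r i * A.d (i+1) (Q (i+1)) \<le> A.d i (Q (i+1))"
    by metis
  \<comment> \<open>Consecutive factors have quotient \<open>r i\<close>, which balances the
    neighbours. The intersection keeps out indices where nothing is known about \<open>r\<close>, so
    \<open>c i\<close> is positive for every \<open>i\<close>, including the base.\<close>
  define c where "c i = (\<Prod>k\<in>{1..<i} \<inter> {1..n-2}. r k)" for i
  have c_pos: "c i > 0" for i unfolding c_def using r by (intro prod_pos) auto
  have c_Suc: "c (i+1) = c i * r i" if i: "i \<in> {1..n-2}" for i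
  proof -
    have "{1..<i+1} \<inter> {1..n-2} = insert i ({1..<i} \<inter> {1..n-2})" using i by auto
    then show ?thesis by (simp add: c_def)
  qed
  interpret B: side_normals n P "\<lambda>i. c i *\<^sub>R a i"
    using c_pos by (intro A.scaled_normals)
  have d: "B.d i x = c i * A.d i x" for i x by (simp add: A.d_def B.d_def)
  interpret B: balanced_normals n P "\<lambda>i. c i *\<^sub>R a i" Q
  proof
    fix i assume "i \<in> {1..n-1}"
    then show "B.d i (Q i) < 0" "B.d n (Q i) > 0"
      using neg base c_pos by (simp_all add: d mult_pos_neg)
  next
    fix i assume i: "i \<in> {1..n-2}"
    show "B.d i (Q i) \<le> B.d (i+1) (Q i)"
      using r[OF i] c_pos[of i] c_Suc[OF i] by (simp add: d mult.assoc)
    show "B.d (i+1) (Q (i+1)) \<le> B.d i (Q (i+1))"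
      using r[OF i] c_pos[of i] c_Suc[OF i] by (simp add: d mult.assoc)
  qed
  have "visible_through (Q i) (P i) (P (i+1)) x" if "i \<in> {1..n-1}" "x \<in> B.cell i" for i x
    using B.cell_cross[OF that triangle_corners(2)]
    unfolding visible_through_def by (metis closed_segment_commute disjoint_iff)
  then show ?thesis
    using B.polytope_cell B.interior_cell_nonempty B.Union_cells B.interior_cells_disjoint
      B.convex_cell_Un
    by (intro exI[of _ B.cell]) (auto simp: is_convex_polygon_def subdivides_def)
qed

end
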